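(* Let $\{P_n(x)\}_{n=0}^{\infty}$ be the sequence of polynomials defined by $P_0(x)=1$ and $$P_{n+1}(x)=A_n(x)P_n'(x)+B_n(x)P_n(x),\qquad n=0,1,\dots,$$ where $A_n(x)$ and $B_n(x)$ are polynomials in $x$ of degree at most $2$ and $1$ respectively, and $P_n$ has degree $n$. Denote the zeros of $P_n(x)$ in increasing order by $\gamma_{i,n}$, $i=1,\dots,n$. Let $$K_n(x)=\exp\left(\int^{x}\frac{B_n(t)}{A_n(t)}\,dt\right).$$ Let $N\ge 1$ be an integer and let $$-\infty\le\alpha_{n+1}\le\alpha_n<\beta_n\le\beta_{n+1}\le\infty ,\qquad 1\le n\le N,$$ and suppose that $K_n(x)$ is continuous on $[\alpha_n,\beta_n]$ and differentiable on $(\alpha_n,\beta_n)$ for $1\le n\le N$. Then: (a) If $K_n(x)=0$ only at $x=\alpha_n$ and $x=\beta_n$ for $1\le n\le N$ and $\alpha_1<\gamma_{1,1}<\beta_1$, then the zeros of $P_n$ and $P_{n+1}$ interlace and are in the interval $(\alpha_n,\beta_n)$ for $1\le n\le N$. (b) If $K_n(x)=0$ only when $x=\alpha_n$ (respectively $\beta_n$), $\frac{A_n(x)}{K_n(x)}=0$ when $x=\beta_n$ (respectively $\alpha_n$), $\beta_n<\beta_{n+1}$ for $1\le n\le N$ (respectively $\alpha_{n+1}<\alpha_n$ for $1\le n\le N$) and $\alpha_1<\gamma_{1,1}<\beta_1$, then the zeros of $P_n$ and $P_{n+1}$ interlace and are in the interval $(\alpha_n,\beta_n)$ for $1\le n\le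 N$. (c) If $K_n(x)=0$ only when $x=\alpha_n$ (respectively $\beta_n$), $\frac{A_n(x)}{K_n(x)}=0$ when $x=\beta_n$ (respectively $\alpha_n$) for $1\le n\le N$ and $\alpha_1<\gamma_{1,1}\le\beta_1$ (respectively $\alpha_1\le\gamma_{1,1}<\beta_1$), then all the zeros of $P_n$ are real, simple and in the interval $(\alpha_n,\beta_n]$ (respectively $[\alpha_n,\beta_n)$) for $1\le n\le N$. (d) If $K_n(x)\ne 0$, $\frac{A_n(x)}{K_n(x)}=0$ when $x=\alpha_n,\beta_n$ and $\alpha_{n+1}<\alpha_n<\beta_n<\beta_{n+1}$ for $1\le n\le N$ with $\alpha_1<\gamma_{1,1}<\beta_1$, then the zeros of $P_n$ and $P_{n+1}$ interlace for $1\le n\le N$.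
   Context: The integral defining $K_n$ is an indefinite integral, so $K_n$ is determined up to a nonzero multiplicative constant; with this definition the recurrence reads $P_{n+1}=\frac{A_n}{K_n}\frac{d}{dx}[K_nP_n]$. The endpoints $\alpha_n,\beta_n$ lie in the extended real line $(-\infty,\infty)\cup\{-\infty,\infty\}$; for a function $f$, $f(\pm\infty)=0$ means $\lim_{x\to\pm\infty}f(x)=0$. The zeros of $P_n$ and $P_{n+1}$ (of degrees $n$ and $n+1$) interlace if they are all real and simple and $$\gamma_{1,n+1}<\gamma_{1,n}<\gamma_{2,n+1}<\gamma_{2,n}<\dots<\gamma_{n,n+1}<\gamma_{n,n}<\gamma_{n+1,n+1}.$$
   Formalization: Parts (a)–(c) also assume that K_nP_n → 0 at an infinite endpoint where K_n → 0 (in (c) only for n<N); in (b) the zeros of P_{n+1} are placed in (α_n,β_n] (resp. [α_n,β_n)), since P_{n+1} vanishes at that endpoint; K_n has finite limits at infinite endpoints. *)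

theory Defs
  imports "HOL-Analysis.Analysis" "HOL-Computational_Algebra.Computational_Algebra"
begin

definition vanishes_at :: "(real \<Rightarrow> real) \<Rightarrow> ereal \<Rightarrow> bool" where
  "vanishes_at f e \<longleftrightarrow>
     (case e of ereal r \<Rightarrow> f r = 0 | PInfty \<Rightarrow> (f \<longlongrightarrow> 0) at_top | MInfty \<Rightarrow> (f \<longlongrightarrow> 0) at_bot)"

definition ext_zeros :: "(real \<Rightarrow> real) \<Rightarrow> ereal \<Rightarrow> ereal \<Rightarrow> ereal set" where
  "ext_zeros f a b = {e \<in> {a..b}. vanishes_at f e}"

text \<open>Continuity of a real-valued function on the closed interval \<open>[a, b]\<close> of the extended real
  line: at an infinite endpoint that belongs to the interval, a finite limit has to exist.\<close>

definition ext_continuous_on :: "ereal \<Rightarrow> ereal \<Rightarrow> (real \<Rightarrow> real) \<Rightarrow> bool" where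
  "ext_continuous_on a b f \<longleftrightarrow>
     continuous_on {x. ereal x \<in> {a..b}} f \<and>
     (a = -\<infinity> \<longrightarrow> (\<exists>L. (f \<longlongrightarrow> L) at_bot)) \<and>
     (b = \<infinity> \<longrightarrow> (\<exists>L. (f \<longlongrightarrow> L) at_top))"

text \<open>\<open>K(x) = exp (\<integral>\<^sup>x B(t)/A(t) dt)\<close> on the open interval \<open>(a, b)\<close>, where \<open>F\<close> is the indefinite
  integral and \<open>c\<close> is the undetermined multiplicative constant. The integrand has to be defined,
  so \<open>A\<close> has no zero in \<open>(a, b)\<close>. The values of \<open>K\<close> at finite endpoints are not fixed here; they
  are determined by continuity on \<open>[a, b]\<close>.\<close>

definition is_weight ::
  "real poly \<Rightarrow> real poly \<Rightarrow> ereal \<Rightarrow> ereal \<Rightarrow> (real \<Rightarrow> real) \<Rightarrow> bool" where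
  "is_weight A B a b K \<longleftrightarrow>
     (\<exists>c F. c \<noteq> 0 \<and>
        (\<forall>x. ereal x \<in> {a<..<b} \<longrightarrow>
           poly A x \<noteq> 0 \<and>
           (F has_real_derivative poly B x / poly A x) (at x) \<and>
           K x = c * exp (F x)))"

text \<open>Wherever \<open>K\<close> vanishes at an endpoint, so does \<open>K p\<close>. This is automatic at finite endpoints.
  At an infinite endpoint it excludes a \<open>K\<close> that decays only like a power too weak to compensate
  the growth of \<open>p\<close>. For example, with \<open>P\<^sub>1 = x\<close>, \<open>A\<^sub>1 = 1 + x\<^sup>2\<close>, \<open>B\<^sub>1 = -x/2\<close> the function
  \<open>K\<^sub>1 = (1 + x\<^sup>2) powr (-1/4)\<close> tends to 0 at both infinities, but \<open>P\<^sub>2 = 1 + x\<^sup>2/2\<close> has no real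
  zero.\<close>

definition keeps_vanishing :: "(real \<Rightarrow> real) \<Rightarrow> real poly \<Rightarrow> ereal \<Rightarrow> ereal \<Rightarrow> bool" where
  "keeps_vanishing K p a b \<longleftrightarrow>
     (\<forall>e\<in>{a, b}. vanishes_at K e \<longrightarrow> vanishes_at (\<lambda>x. K x * poly p x) e)"

text \<open>The \<open>i\<close>-th real zero in increasing order, \<open>i\<close> counted from 1 (each zero is listed once).\<close>

definition nth_zero :: "nat \<Rightarrow> real poly \<Rightarrow> real" where
  "nth_zero i p = sorted_list_of_set {x. poly p x = 0} ! (i - 1)"

definition zeros_real_simple :: "real poly \<Rightarrow> bool" where
  "zeros_real_simple p \<longleftrightarrow>
     (\<forall>z::complex. poly (map_poly of_real p) z = 0 \<longrightarrow>
        z \<in> \<real> \<and> order z (map_poly of_real p) = 1)"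

definition zeros_in :: "real poly \<Rightarrow> ereal set \<Rightarrow> bool" where
  "zeros_in p S \<longleftrightarrow> (\<forall>x. poly p x = 0 \<longrightarrow> ereal x \<in> S)"

text \<open>Meant for \<open>degree q = degree p + 1\<close>.\<close>

definition zeros_interlace :: "real poly \<Rightarrow> real poly \<Rightarrow> bool" where
  "zeros_interlace p q \<longleftrightarrow>
     zeros_real_simple p \<and> zeros_real_simple q \<and>
     (\<forall>i\<in>{1..degree p}. nth_zero i q < nth_zero i p \<and> nth_zero i p < nth_zero (i + 1) q)"

end

theory Submission
  imports Defs
begin

text \<open>
  Since \<open>K' = K B / A\<close>, the recurrence \<open>q = A p' + B p\<close> says \<open>(K p)' = (K / A) q\<close>: inside
  \<open>(a, b)\<close>, the zeros of \<open>q\<close> are the critical points of \<open>K p\<close>. By Rolle's theorem there is one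
  strictly between any two neighbouring zeros of \<open>p\<close>, and also one between the outermost zero of \<open>p\<close>
  and an endpoint at which \<open>K p\<close> vanishes; infinite endpoints need the version of Rolle's theorem in
  \<open>Rolle_extended\<close>.

  An endpoint \<open>e\<close> at which \<open>A / K\<close> vanishes but \<open>K\<close> does not is itself a zero of \<open>q\<close>
  (\<open>endpoint_zero\<close>). It is finite, because a polynomial \<open>A\<close> that is not zero does not tend to 0 at
  infinity. So \<open>A e = 0\<close>, and then \<open>B e = 0\<close> as well: otherwise \<open>B / A\<close>, the logarithmic derivative
  of \<open>K\<close>, would grow at least like \<open>1 / \<bar>x - e\<bar>\<close>, and \<open>K\<close> could not have a finite nonzero limit
  at \<open>e\<close>. Hence \<open>q e = A e p' e + B e p e = 0\<close>.

  Either way each endpoint contributes one zero of \<open>q\<close>. With \<open>n\<close> zeros of \<open>p\<close> this makes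
  \<open>(n - 1) + 2 = n + 1\<close> distinct real zeros of \<open>q\<close>, as many as its degree; so these are all its
  zeros, they are simple, and they separate the zeros of \<open>p\<close>. The argument still works if an outermost
  zero of \<open>p\<close> sits at an endpoint where \<open>K\<close> does not vanish, except that \<open>q\<close> then shares this zero
  with \<open>p\<close>. Therefore one lemma, \<open>weighted_raising.next_zeros\<close>, carries all parts of the theorem: the
  zeros stay in the set of points of \<open>[a, b]\<close> where \<open>K\<close> does not vanish, and they interlace strictly if
  the zeros of \<open>p\<close> avoid the endpoints. The parts differ only in how that set sits in the next
  interval. In (a), (b) and (d) it lies in the open interval \<open>(\<alpha>\<^sub>n\<^sub>+\<^sub>1, \<beta>\<^sub>n\<^sub>+\<^sub>1)\<close>, which gives interlacing
  at every step; in (c) an endpoint may be kept, and only the location of the zeros propagates.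
\<close>

section \<open>Polynomials with as many distinct real zeros as their degree\<close>

definition enumerates_zeros :: "(nat \<Rightarrow> real) \<Rightarrow> real poly \<Rightarrow> bool" where
  "enumerates_zeros \<gamma> p \<longleftrightarrow>
     p \<noteq> 0 \<and> strict_mono_on {1..degree p} \<gamma> \<and> (\<forall>i\<in>{1..degree p}. poly p (\<gamma> i) = 0)"

lemma enumerates_zeros_roots:
  assumes "enumerates_zeros \<gamma> p"
  shows "{x. poly p x = 0} = \<gamma> ` {1..degree p}"
proof -
  have "finite {x. poly p x = 0}"
    using assms poly_roots_finite by (auto simp: enumerates_zeros_def)
  moreover have "\<gamma> ` {1..degree p} \<subseteq> {x. poly p x = 0}"
    using assms by (auto simp: enumerates_zeros_def)
  moreover have "card (\<gamma> ` {1..degree p}) = degree p"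
    using assms by (simp add: enumerates_zeros_def card_image strict_mono_on_imp_inj_on)
  moreover have "card {x. poly p x = 0} \<le> degree p"
    using assms card_poly_roots_bound by (auto simp: enumerates_zeros_def)
  ultimately show ?thesis
    by (metis card_seteq)
qed

lemma enumerates_zeros_nth_zero:
  assumes "enumerates_zeros \<gamma> p" "i \<in> {1..degree p}"
  shows "nth_zero i p = \<gamma> i"
proof -
  let ?xs = "map \<gamma> [1..<Suc (degree p)]"
  have mono: "strict_mono_on {1..degree p} \<gamma>"
    using assms by (simp add: enumerates_zeros_def)
  have "sorted_wrt (<) ?xs"
    unfolding sorted_wrt_iff_nth_less
    by (auto simp del: upt_Suc intro!: strict_mono_onD[OF mono])
  then have "sorted_list_of_set (set ?xs) = ?xs"
    by (metis sorted_list_of_set.idem_if_sorted_distinct strict_sorted_iff)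
  moreover have "set ?xs = \<gamma> ` {1..degree p}"
    by (simp add: atLeastLessThanSuc_atLeastAtMost del: upt_Suc)
  ultimately have "nth_zero i p = ?xs ! (i - 1)"
    using enumerates_zeros_roots[OF assms(1)] by (simp add: nth_zero_def del: upt_Suc)
  also have "\<dots> = \<gamma> i"
    using assms(2) by (auto simp del: upt_Suc)
  finally show ?thesis .
qed

lemma enumerates_zeros_in:
  assumes "enumerates_zeros \<gamma> p" "\<And>i. i \<in> {1..degree p} \<Longrightarrow> ereal (\<gamma> i) \<in> S"
  shows "zeros_in p S"
  unfolding zeros_in_def
proof (intro allI impI)
  fix x assume "poly p x = 0"
  then have "x \<in> \<gamma> ` {1..degree p}"
    using enumerates_zeros_roots[OF assms(1)] by auto
  then show "ereal x \<in> S"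
    using assms(2) by auto
qed

text \<open>The zeros stay simple over the complex numbers since the multiplicities add up to at most the
  degree, so that \<open>degree p\<close> distinct zeros leave room for nothing else.\<close>

lemma enumerates_zeros_real_simple:
  assumes "enumerates_zeros \<gamma> p"
  shows "zeros_real_simple p"
proof -
  let ?q = "map_poly of_real p :: complex poly"
  let ?Z = "(\<lambda>i. complex_of_real (\<gamma> i)) ` {1..degree p}"
  have p: "p \<noteq> 0" "strict_mono_on {1..degree p} \<gamma>" "\<And>i. i \<in> {1..degree p} \<Longrightarrow> poly p (\<gamma> i) = 0"
    using assms by (auto simp: enumerates_zeros_def)
  have q: "?q \<noteq> 0" "degree ?q = degree p"
    using p by (simp_all add: map_poly_eq_0_iff degree_map_poly)
  have of_real: "poly ?q (of_real x) = of_real (poly p x)" for x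
    by (induction p) (auto simp: map_poly_pCons)
  have Z: "?Z \<subseteq> {z. poly ?q z = 0}"
    using p(3) of_real by auto
  have "card ?Z = degree p"
    using strict_mono_on_imp_inj_on[OF p(2)]
    by (subst card_image) (auto intro!: inj_onI simp: inj_on_eq_iff)
  moreover have fin: "finite {z. poly ?q z = 0}"
    using poly_roots_finite q(1) by blast
  moreover have "card {z. poly ?q z = 0} \<le> degree p"
    using card_poly_roots_bound[OF q(1)] q(2) by simp
  ultimately have roots: "{z. poly ?q z = 0} = ?Z"
    using Z by (metis card_seteq)
  have sub: "mset_set (set_mset (proots ?q)) \<subseteq># proots ?q"
    by (rule mset_set_set_mset_msubset)
  have "size (mset_set (set_mset (proots ?q))) = degree p"
    using roots \<open>card ?Z = degree p\<close> q by simp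
  then have "mset_set (set_mset (proots ?q)) = proots ?q"
    using sub size_proots_le[of ?q] q(2)
    by (metis mset_subset_size subset_mset.le_imp_less_or_eq linorder_not_le)
  then have "count (proots ?q) z = count (mset_set {z. poly ?q z = 0}) z" for z
    using q(1) by simp
  then have "order z ?q = 1" if "poly ?q z = 0" for z
    using that q(1) fin by simp
  moreover have "z \<in> \<real>" if "poly ?q z = 0" for z
    using that roots by (auto simp: set_eq_iff)
  ultimately show ?thesis
    by (simp add: zeros_real_simple_def)
qed

lemma enumerates_zeros_interlace:
  assumes "enumerates_zeros \<gamma> p" "enumerates_zeros \<delta> q" "degree q = degree p + 1"
    and "\<And>i. i \<in> {1..degree p} \<Longrightarrow> \<delta> i < \<gamma> i \<and> \<gamma> i < \<delta> (i + 1)"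
  shows "zeros_interlace p q"
  using assms enumerates_zeros_real_simple
  by (auto simp: zeros_interlace_def enumerates_zeros_nth_zero)

section \<open>Interlacing from a zero in every gap\<close>

lemma strict_mono_on_atLeastAtMost_Suc:
  fixes f :: "nat \<Rightarrow> 'a::preorder"
  assumes "\<And>i. i \<in> {m..<n} \<Longrightarrow> f i < f (Suc i)"
  shows "strict_mono_on {m..n} f"
proof (rule strict_mono_onI)
  fix i j assume "i \<in> {m..n}" "j \<in> {m..n}" "i < j"
  then have "Suc i \<le> j" by simp
  then show "f i < f j" using \<open>i \<in> {m..n}\<close> \<open>j \<in> {m..n}\<close>
  proof (induction j rule: dec_induct)
    case base
    then show ?case using assms by simp
  next
    case (step k)
    then have "f i < f k" by simp
    also have "f k < f (Suc k)" using step assms by simp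
    finally show ?case .
  qed
qed

text \<open>The outer points \<open>L\<close> and \<open>R\<close> may coincide with \<open>\<gamma> 1\<close> and \<open>\<gamma> n\<close>: this occurs when a zero sits at an
  endpoint of the interval. For \<open>n = 1\<close> no gap keeps the two apart, hence the assumption \<open>L < R\<close>.\<close>

lemma interlacing_sequence_from_gaps:
  fixes \<gamma> :: "nat \<Rightarrow> real"
  assumes n: "1 \<le> n"
    and gap: "\<And>i. i \<in> {1..<n} \<Longrightarrow> \<exists>x. Q x \<and> \<gamma> i < x \<and> x < \<gamma> (i + 1)"
    and L: "Q L" "L \<le> \<gamma> 1" and R: "Q R" "\<gamma> n \<le> R" and LR: "L < R"
  obtains \<delta> where "strict_mono_on {1..n + 1} \<delta>" "\<And>i. i \<in> {1..n + 1} \<Longrightarrow> Q (\<delta> i)"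
    "\<delta> 1 = L" "\<delta> (n + 1) = R" "\<And>i. i \<in> {1..<n} \<Longrightarrow> \<gamma> i < \<delta> (i + 1) \<and> \<delta> (i + 1) < \<gamma> (i + 1)"
proof -
  obtain d where d: "\<And>i. i \<in> {1..<n} \<Longrightarrow> Q (d i) \<and> \<gamma> i < d i \<and> d i < \<gamma> (i + 1)"
    using gap by metis
  define \<delta> where "\<delta> i = (if i = 1 then L else if i = n + 1 then R else d (i - 1))" for i
  have ends: "\<delta> 1 = L" "\<delta> (n + 1) = R"
    using n by (auto simp: \<delta>_def)
  have mid: "Q (\<delta> (i + 1)) \<and> \<gamma> i < \<delta> (i + 1) \<and> \<delta> (i + 1) < \<gamma> (i + 1)" if "i \<in> {1..<n}" for i
    using that d[of i] by (auto simp: \<delta>_def)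
  have upper: "\<delta> i \<le> \<gamma> i" "1 < i \<Longrightarrow> \<delta> i < \<gamma> i" if "i \<in> {1..n}" for i
    using that mid[of "i - 1"] ends L by (cases "i = 1"; force)+
  have lower: "\<gamma> i \<le> \<delta> (i + 1)" "i < n \<Longrightarrow> \<gamma> i < \<delta> (i + 1)" if "i \<in> {1..n}" for i
    using that mid[of i] ends R by (cases "i = n"; force)+
  have "\<delta> i < \<delta> (Suc i)" if "i \<in> {1..<n + 1}" for i
  proof (cases "1 < i \<or> i < n")
    case True
    then show ?thesis using that upper[of i] lower[of i] by force
  next
    case False
    then have "i = 1" "n = 1" using that by auto
    then show ?thesis using ends LR by simp
  qed
  then have "strict_mono_on {1..n + 1} \<delta>"
    by (rule strict_mono_on_atLeastAtMost_Suc)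
  moreover have "Q (\<delta> i)" if i: "i \<in> {1..n + 1}" for i
  proof -
    consider "i = 1" | "i = n + 1" | "i - 1 \<in> {1..<n}" "i - 1 + 1 = i"
      using i by (cases "i = 1 \<or> i = n + 1") auto
    then show ?thesis
      using mid[of "i - 1"] ends L R by cases auto
  qed
  ultimately show thesis
    using that[of \<delta>] ends mid by blast
qed

section \<open>Rolle's theorem on intervals of the extended real line\<close>

lemma vanishes_at_ereal [simp]: "vanishes_at f (ereal r) \<longleftrightarrow> f r = 0"
  by (simp add: vanishes_at_def)

text \<open>This and its mirror image treat finite and infinite endpoints alike: at a finite endpoint the
  point found is the endpoint itself, at an infinite one it comes from the limit.\<close>

lemma vanishes_at_left_small:
  assumes "vanishes_at f u" "u < ereal x" "0 < c"
  obtains y where "u \<le> ereal y" "y < x" "\<bar>f y\<bar> < c"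
proof (cases u)
  case (real r)
  then show ?thesis using assms that[of r] by simp
next
  case MInf
  then have "(f \<longlongrightarrow> 0) at_bot" using assms by (simp add: vanishes_at_def)
  then have "\<forall>\<^sub>F y in at_bot. \<bar>f y\<bar> < c" using \<open>0 < c\<close> by (auto simp: tendsto_iff)
  then have "\<forall>\<^sub>F y in at_bot. \<bar>f y\<bar> < c \<and> y < x"
    using eventually_conj eventually_gt_at_bot eventually_at_bot_dense by blast
  then obtain y where "\<bar>f y\<bar> < c" "y < x"
    using eventually_happens'[OF trivial_limit_at_bot_linorder] by blast
  then show ?thesis using that MInf by simp
next
  case PInf
  then show ?thesis using assms by simp
qed

lemma vanishes_at_right_small:
  assumes "vanishes_at f v" "ereal x < v" "0 < c"
  obtains y where "ereal y \<le> v" "x < y" "\<bar>f y\<bar> < c"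
proof (cases v)
  case (real r)
  then show ?thesis using assms that[of r] by simp
next
  case PInf
  then have "(f \<longlongrightarrow> 0) at_top" using assms by (simp add: vanishes_at_def)
  then have "\<forall>\<^sub>F y in at_top. \<bar>f y\<bar> < c" using \<open>0 < c\<close> by (auto simp: tendsto_iff)
  then have "\<forall>\<^sub>F y in at_top. \<bar>f y\<bar> < c \<and> x < y"
    using eventually_conj eventually_gt_at_top by blast
  then obtain y where "\<bar>f y\<bar> < c" "x < y"
    using eventually_happens'[OF trivial_limit_at_top_linorder] by blast
  then show ?thesis using that PInf by simp
next
  case MInf
  then show ?thesis using assms by simp
qed

lemma vanishes_at_uminus [simp]: "vanishes_at (\<lambda>x. - f x) e \<longleftrightarrow> vanishes_at f e"
  using tendsto_minus_cancel_left[of f 0] by (cases e) (simp_all add: vanishes_at_def)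

text \<open>The level \<open>f x / 2\<close> is attained on both sides of \<open>x\<close> at real points, so that the classical
  theorem applies between them.\<close>

lemma Rolle_extended_positive:
  fixes f f' :: "real \<Rightarrow> real" and u v :: ereal
  assumes cont: "continuous_on {x. ereal x \<in> {u..v}} f"
    and deriv: "\<And>x. u < ereal x \<Longrightarrow> ereal x < v \<Longrightarrow> (f has_real_derivative f' x) (at x)"
    and zero: "vanishes_at f u" "vanishes_at f v"
    and x: "u < ereal x" "ereal x < v" "0 < f x"
  shows "\<exists>z. u < ereal z \<and> ereal z < v \<and> f' z = 0"
proof -
  have cont': "continuous_on {y..z} f" if "u \<le> ereal y" "ereal z \<le> v" for y z
    using cont by (rule continuous_on_subset)
      (use that in \<open>auto intro: order.trans[of u "ereal y"] order.trans[of _ "ereal z" v]\<close>)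
  obtain l where l: "u \<le> ereal l" "l < x" "\<bar>f l\<bar> < f x / 2"
    using vanishes_at_left_small[OF zero(1) x(1), of "f x / 2"] x(3) by auto
  obtain r where r: "ereal r \<le> v" "x < r" "\<bar>f r\<bar> < f x / 2"
    using vanishes_at_right_small[OF zero(2) x(2), of "f x / 2"] x(3) by auto
  obtain y where y: "l \<le> y" "y \<le> x" "f y = f x / 2"
    using IVT'[of f l "f x / 2" x] l x cont'[of l x] order.strict_implies_order[OF x(2)] by force
  obtain z where z: "x \<le> z" "z \<le> r" "f z = f x / 2"
    using IVT2'[of f r "f x / 2" x] r x cont'[of x r] order.strict_implies_order[OF x(1)] by force
  have "y \<noteq> x" "x \<noteq> z" using y z x(3) by auto
  then have "y < z" using y z by simp
  have in_uv: "u < ereal t \<and> ereal t < v" if "y < t" "t < z" for t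
    using that y(1) z(2) l(1) r(1)
    by (metis ereal_less_eq(3) less_ereal.simps(1) order_le_less_trans order_less_le_trans)
  have "u \<le> ereal y" "ereal z \<le> v"
    using y(1) z(2) l(1) r(1) by (metis ereal_less_eq(3) order.trans)+
  then have "\<exists>t. y < t \<and> t < z \<and> (*) (f' t) = (\<lambda>v. 0)"
    using in_uv deriv y(3) z(3) \<open>y < z\<close>
    by (intro Rolle_deriv[of y z f] cont') (auto simp: has_field_derivative_def)
  then show ?thesis
    using in_uv by (metis mult.right_neutral)
qed

lemma Rolle_extended:
  fixes f f' :: "real \<Rightarrow> real" and u v :: ereal
  assumes "u < v" and cont: "continuous_on {x. ereal x \<in> {u..v}} f"
    and deriv: "\<And>x. u < ereal x \<Longrightarrow> ereal x < v \<Longrightarrow> (f has_real_derivative f' x) (at x)"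
    and zero: "vanishes_at f u" "vanishes_at f v"
  shows "\<exists>z. u < ereal z \<and> ereal z < v \<and> f' z = 0"
proof (cases "\<exists>x. u < ereal x \<and> ereal x < v \<and> f x \<noteq> 0")
  case True
  then obtain x where x: "u < ereal x" "ereal x < v" "f x \<noteq> 0" by blast
  show ?thesis
  proof (cases "0 < f x")
    case True
    with cont deriv zero x(1,2) show ?thesis by (rule Rolle_extended_positive)
  next
    case False
    have "\<exists>z. u < ereal z \<and> ereal z < v \<and> - f' z = 0"
      by (rule Rolle_extended_positive[of u v "\<lambda>x. - f x" "\<lambda>x. - f' x" x])
        (use False x cont deriv zero in \<open>auto intro!: continuous_intros derivative_eq_intros\<close>)
    then show ?thesis by simp
  qed
next
  case False
  obtain x where x: "u < ereal x" "ereal x < v"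
    using ereal_dense2 \<open>u < v\<close> by blast
  have "open {x. u < ereal x \<and> ereal x < v}"
    using open_ereal_vimage[of "{u<..<v}"] by (simp add: vimage_def)
  then have "(f has_real_derivative 0) (at x)"
    using False x by (intro has_field_derivative_transform_within_open[OF DERIV_const[of 0]]) auto
  then show ?thesis
    using deriv x DERIV_unique by blast
qed

section \<open>Endpoints at which the coefficient of the derivative vanishes\<close>

text \<open>The mean value theorem on \<open>[t/2, t]\<close> compares the increment of \<open>g\<close>, which tends to 0 since \<open>g\<close> has
  a limit, with \<open>t/2\<close> times \<open>g' = g b / a\<close>. As \<open>a\<close> vanishes at 0, its size there is \<open>O(t)\<close>, the factor
  \<open>t/2\<close> cancels it, and \<open>g b\<close> tends to 0.\<close>

lemma log_derivative_limit_zero: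
  fixes g :: "real \<Rightarrow> real" and a b :: "real poly"
  assumes "0 < h" and deriv: "\<And>t. 0 < t \<Longrightarrow> t < h \<Longrightarrow>
      poly a t \<noteq> 0 \<and> (g has_real_derivative g t * poly b t / poly a t) (at t)"
    and lim: "(g \<longlongrightarrow> l) (at_right 0)" and a0: "poly a 0 = 0"
  shows "l * poly b 0 = 0"
proof -
  obtain c where c: "a = [:0, 1:] * c"
    using a0 by (metis poly_eq_0_iff_dvd dvdE minus_zero)
  have "\<exists>\<xi>. t / 2 < \<xi> \<and> \<xi> < t \<and>
      \<bar>g \<xi> * poly b \<xi>\<bar> \<le> 2 * \<bar>g t - g (t / 2)\<bar> * \<bar>poly c \<xi>\<bar>" if t: "0 < t" "t < h" for t
  proof -
    obtain \<xi> where \<xi>: "t / 2 < \<xi>" "\<xi> < t"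
        "g t - g (t / 2) = (t - t / 2) * (g \<xi> * poly b \<xi> / poly a \<xi>)"
      using MVT2[of "t / 2" t g "\<lambda>x. g x * poly b x / poly a x"] deriv t by auto
    moreover have "poly a \<xi> \<noteq> 0"
      using deriv[of \<xi>] \<xi> t by simp
    ultimately have "g \<xi> * poly b \<xi> = 2 * (g t - g (t / 2)) * poly c \<xi> * (\<xi> / t)"
      using t by (auto simp: c field_simps)
    moreover have "0 < \<xi> / t" "\<xi> / t \<le> 1"
      using \<xi> t by simp_all
    ultimately have "\<bar>g \<xi> * poly b \<xi>\<bar> = 2 * \<bar>g t - g (t / 2)\<bar> * \<bar>poly c \<xi>\<bar> * (\<xi> / t)"
      by (simp only: abs_mult abs_of_pos abs_numeral)
    also have "\<dots> \<le> 2 * \<bar>g t - g (t / 2)\<bar> * \<bar>poly c \<xi>\<bar>"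
      using \<open>\<xi> / t \<le> 1\<close> by (intro mult_left_le) auto
    finally show ?thesis
      using \<xi>(1,2) by blast
  qed
  then obtain \<xi> where \<xi>: "\<And>t. 0 < t \<Longrightarrow> t < h \<Longrightarrow> t / 2 < \<xi> t \<and> \<xi> t < t \<and>
      \<bar>g (\<xi> t) * poly b (\<xi> t)\<bar> \<le> 2 * \<bar>g t - g (t / 2)\<bar> * \<bar>poly c (\<xi> t)\<bar>"
    by metis
  have near: "\<forall>\<^sub>F t in at_right 0. 0 < t \<and> t < h"
    using \<open>0 < h\<close> by (simp add: eventually_at_right_less eventually_at_right_field eventually_conj_iff)
      auto
  have id0: "((\<lambda>t::real. t) \<longlongrightarrow> 0) (at_right 0)"
    by (rule tendsto_ident_at)
  have "(\<xi> \<longlongrightarrow> 0) (at_right 0)"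
    by (rule tendsto_sandwich[OF _ _ tendsto_const id0]; rule eventually_mono[OF near])
      (use \<xi> in force)+
  then have \<xi>0: "filterlim \<xi> (at_right 0) (at_right 0)"
    unfolding filterlim_at using \<xi> by (auto intro!: eventually_mono[OF near]) force+
  have half: "filterlim (\<lambda>t::real. t / 2) (at_right 0) (at_right 0)"
    unfolding filterlim_at using tendsto_divide[OF id0 tendsto_const[of "2::real"]]
    by (auto intro!: eventually_mono[OF near])
  have poly_lim: "((\<lambda>t. poly q (\<xi> t)) \<longlongrightarrow> poly q 0) (at_right 0)" for q
    using \<open>(\<xi> \<longlongrightarrow> 0) (at_right 0)\<close> by (rule tendsto_poly)
  have "((\<lambda>t. 2 * \<bar>g t - g (t / 2)\<bar> * \<bar>poly c (\<xi> t)\<bar>) \<longlongrightarrow> 2 * \<bar>l - l\<bar> * \<bar>poly c 0\<bar>) (at_right 0)"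
    by (intro tendsto_intros lim filterlim_compose[OF lim half] poly_lim)
  moreover have "\<forall>\<^sub>F t in at_right 0.
      norm (g (\<xi> t) * poly b (\<xi> t)) \<le> 2 * \<bar>g t - g (t / 2)\<bar> * \<bar>poly c (\<xi> t)\<bar>"
    by (rule eventually_mono[OF near]) (simp only: real_norm_def \<xi>)
  ultimately have "((\<lambda>t. g (\<xi> t) * poly b (\<xi> t)) \<longlongrightarrow> 0) (at_right 0)"
    by (simp add: Lim_null_comparison)
  moreover have "((\<lambda>t. g (\<xi> t) * poly b (\<xi> t)) \<longlongrightarrow> l * poly b 0) (at_right 0)"
    by (intro tendsto_mult filterlim_compose[OF lim \<xi>0] poly_lim)
  ultimately show ?thesis
    using tendsto_unique trivial_limit_at_right_real by blast
qed

lemma poly_tendsto_zero_imp_zero: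
  fixes p :: "real poly"
  assumes "(poly p \<longlongrightarrow> 0) F" "F \<le> at_infinity" "F \<noteq> bot"
  shows "p = 0"
proof (cases "degree p = 0")
  case True
  then obtain c where "p = [:c:]"
    by (metis degree_eq_zeroE)
  then show ?thesis
    using assms(1,3) tendsto_const_iff[of F c 0] by (simp add: poly_pCons[abs_def])
next
  case False
  then have "filterlim (poly p) at_infinity F"
    using filterlim_poly_at_infinity[of p] filterlim_mono[OF _ order_refl assms(2)] by blast
  then show ?thesis
    using assms not_tendsto_and_filterlim_at_infinity by blast
qed

section \<open>One step of the recurrence\<close>

text \<open>The recurrence takes \<open>p\<close> to \<open>q = (A / K) (K p)'\<close>.\<close>

locale weighted_raising =
  fixes A B p q :: "real poly" and a b :: ereal and K :: "real \<Rightarrow> real"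
  assumes ab: "a < b"
    and q_eq: "q = A * pderiv p + B * p"
    and weight: "is_weight A B a b K"
    and cont: "ext_continuous_on a b K"
begin

lemma inside:
  assumes "a < ereal x" "ereal x < b"
  shows "poly A x \<noteq> 0" "K x \<noteq> 0"
    and "(K has_real_derivative K x * poly B x / poly A x) (at x)"
proof -
  obtain c F where c: "c \<noteq> 0" and F: "\<And>x. ereal x \<in> {a<..<b} \<Longrightarrow> poly A x \<noteq> 0 \<and>
      (F has_real_derivative poly B x / poly A x) (at x) \<and> K x = c * exp (F x)"
    using weight by (auto simp: is_weight_def)
  have x: "ereal x \<in> {a<..<b}" using assms by simp
  show "poly A x \<noteq> 0" "K x \<noteq> 0" using F[OF x] c by simp_all
  have opn: "open {x. ereal x \<in> {a<..<b}}"
    using open_ereal_vimage[of "{a<..<b}"] by (simp add: vimage_def)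
  have "((\<lambda>x. c * exp (F x)) has_real_derivative K x * poly B x / poly A x) (at x)"
    using F[OF x] by (auto intro!: derivative_eq_intros)
  then show "(K has_real_derivative K x * poly B x / poly A x) (at x)"
    by (rule has_field_derivative_transform_within_open[OF _ opn]) (use x F in simp_all)
qed

lemma weighted_derivative:
  assumes "a < ereal x" "ereal x < b"
  shows "((\<lambda>x. K x * poly p x) has_real_derivative K x * poly q x / poly A x) (at x)"
  using inside(1)[OF assms]
  by (intro DERIV_cong[OF DERIV_mult[OF inside(3)[OF assms] poly_DERIV]])
    (simp add: q_eq field_simps)

lemma zero_between:
  assumes "a \<le> u" "u < v" "v \<le> b"
    and "vanishes_at (\<lambda>x. K x * poly p x) u" "vanishes_at (\<lambda>x. K x * poly p x) v"
  obtains x where "poly q x = 0" "u < ereal x" "ereal x < v" "K x \<noteq> 0"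
proof -
  have "continuous_on {x. ereal x \<in> {a..b}} K"
    using cont by (simp add: ext_continuous_on_def)
  then have "continuous_on {x. ereal x \<in> {u..v}} K"
    by (rule continuous_on_subset) (use assms in auto)
  then have "continuous_on {x. ereal x \<in> {u..v}} (\<lambda>x. K x * poly p x)"
    by (intro continuous_intros)
  moreover have inner: "a < ereal x" "ereal x < b" if "u < ereal x" "ereal x < v" for x
    using that assms by auto
  ultimately have "\<exists>x. u < ereal x \<and> ereal x < v \<and> K x * poly q x / poly A x = 0"
    using Rolle_extended[OF assms(2) _ weighted_derivative assms(4,5)] by blast
  then show thesis
    using that inside inner by force
qed

text \<open>The substitution \<open>x = r + s t\<close> with \<open>s = 1\<close> at the left endpoint and \<open>s = -1\<close> at the right endpoint
  moves \<open>r\<close> to 0 with the interval on its right. It yields \<open>K r * B r = 0\<close>.\<close>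

lemma endpoint_zero_real:
  assumes r: "ereal r \<in> {a, b}" and "K r \<noteq> 0" "poly A r = 0"
  shows "poly q r = 0"
proof -
  obtain s :: real and h where s: "s \<noteq> 0" and h: "0 < h"
    and st: "\<And>t. 0 < t \<Longrightarrow> t < h \<Longrightarrow> a < ereal (r + s * t) \<and> ereal (r + s * t) < b"
  proof (cases "ereal r = a")
    case True
    obtain d where "ereal r < ereal d" "ereal d < b"
      using ereal_dense2 ab True by blast
    then have "a < ereal (r + 1 * t) \<and> ereal (r + 1 * t) < b" if "0 < t" "t < d - r" for t
      using that True order.strict_trans[of "ereal (r + t)" "ereal d" b] by auto
    then show ?thesis
      using that[of 1 "d - r"] \<open>ereal r < ereal d\<close> by simp
  next
    case False
    then have b: "b = ereal r" using r by simp
    obtain d where "a < ereal d" "ereal d < ereal r"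
      using ereal_dense2 ab b by blast
    then have "a < ereal (r + (-1) * t) \<and> ereal (r + (-1) * t) < b" if "0 < t" "t < r - d" for t
      using that b order.strict_trans[of a "ereal d" "ereal (r - t)"] by auto
    then show ?thesis
      using that[of "-1" "r - d"] \<open>ereal d < ereal r\<close> by simp
  qed
  let ?S = "{x. ereal x \<in> {a..b}}"
  have lim: "(K \<longlongrightarrow> K r) (at r within ?S)"
    using cont r ab by (auto simp: ext_continuous_on_def continuous_on_def)
  have near: "\<forall>\<^sub>F t in at_right 0. 0 < t \<and> t < h"
    using h by (simp add: eventually_at_right_less eventually_at_right_field eventually_conj_iff)
      auto
  have "((\<lambda>t. r + s * t) \<longlongrightarrow> r + s * 0) (at_right 0)"
    by (intro tendsto_intros)
  then have "filterlim (\<lambda>t. r + s * t) (at r within ?S) (at_right 0)"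
    unfolding filterlim_at using st s by (auto intro!: eventually_mono[OF near] less_imp_le)
  then have "((\<lambda>t. K (r + s * t)) \<longlongrightarrow> K r) (at_right 0)"
    by (rule filterlim_compose[OF lim])
  moreover have "poly (A \<circ>\<^sub>p [:r, s:]) t \<noteq> 0 \<and> ((\<lambda>t. K (r + s * t)) has_real_derivative
      K (r + s * t) * poly (smult s (B \<circ>\<^sub>p [:r, s:])) t / poly (A \<circ>\<^sub>p [:r, s:]) t) (at t)"
    if "0 < t" "t < h" for t
  proof -
    note in_ab = inside[OF conjunct1[OF st[OF that]] conjunct2[OF st[OF that]]]
    have "((\<lambda>t. r + s * t) has_real_derivative s) (at t)"
      by (auto intro!: derivative_eq_intros)
    from DERIV_chain2[OF in_ab(3) this] in_ab(1) show ?thesis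
      by (simp add: poly_pcompose mult_ac)
  qed
  ultimately have "K r * poly (smult s (B \<circ>\<^sub>p [:r, s:])) 0 = 0"
    using assms(3)
    by (intro log_derivative_limit_zero[of h "A \<circ>\<^sub>p [:r, s:]" "\<lambda>t. K (r + s * t)", OF h])
      (simp_all add: poly_pcompose)
  then have "poly B r = 0"
    using s assms(2) by (simp add: poly_pcompose)
  then show ?thesis
    using assms(3) by (simp add: q_eq)
qed

text \<open>If \<open>K\<close> has a nonzero limit while \<open>A / K\<close> tends to 0, then so does \<open>A\<close>; at infinity this forces
  \<open>A = 0\<close>, against \<open>A \<noteq> 0\<close> inside the interval.\<close>

lemma not_infinite_endpoint:
  assumes "(K \<longlongrightarrow> L) F" "L \<noteq> 0" "((\<lambda>x. poly A x / K x) \<longlongrightarrow> 0) F" "F \<le> at_infinity" "F \<noteq> bot"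
  shows False
proof -
  have "((\<lambda>x. poly A x / K x * K x) \<longlongrightarrow> 0 * L) F"
    by (intro tendsto_mult assms)
  moreover have "\<forall>\<^sub>F x in F. K x \<noteq> 0"
    using assms(1,2) by (rule tendsto_imp_eventually_ne)
  ultimately have "(poly A \<longlongrightarrow> 0) F"
    by (auto elim!: Lim_transform_eventually eventually_mono)
  then have "A = 0"
    using assms(4,5) by (rule poly_tendsto_zero_imp_zero)
  then show False
    using ereal_dense2[OF ab] inside(1) by auto
qed

lemma endpoint_zero:
  assumes e: "e \<in> {a, b}" and K: "\<not> vanishes_at K e" and A: "vanishes_at (\<lambda>x. poly A x / K x) e"
  obtains r where "e = ereal r" "poly q r = 0" "K r \<noteq> 0"
proof (cases e)
  case (real r)
  then show ?thesis
    using assms endpoint_zero_real[of r] that by auto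
next
  case PInf
  then have "b = \<infinity>" using e ab by auto
  then obtain L where L: "(K \<longlongrightarrow> L) at_top" using cont by (auto simp: ext_continuous_on_def)
  moreover have "L \<noteq> 0" using L K PInf by (auto simp: vanishes_at_def)
  ultimately have False
    using A PInf by (intro not_infinite_endpoint[OF L _ _ at_top_le_at_infinity]) (auto simp: vanishes_at_def)
  then show ?thesis ..
next
  case MInf
  then have "a = -\<infinity>" using e ab by auto
  then obtain L where L: "(K \<longlongrightarrow> L) at_bot" using cont by (auto simp: ext_continuous_on_def)
  moreover have "L \<noteq> 0" using L K MInf by (auto simp: vanishes_at_def)
  ultimately have False
    using A MInf by (intro not_infinite_endpoint[OF L _ _ at_bot_le_at_infinity]) (auto simp: vanishes_at_def)
  then show ?thesis ..
qed

text \<open>At each endpoint there are two alternatives. If \<open>K\<close> vanishes there, the outermost zero of \<open>p\<close> is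
  away from the endpoint and Rolle's theorem gives a zero of \<open>q\<close> in between. Otherwise the endpoint is
  itself a zero of \<open>q\<close>; this is why the new zeros are located only up to the endpoints where \<open>K\<close> does
  not vanish.\<close>

lemma next_zeros:
  assumes \<gamma>: "enumerates_zeros \<gamma> p"
    and deg: "1 \<le> degree p" "degree q = degree p + 1"
    and \<gamma>_in: "\<And>i. i \<in> {1..degree p} \<Longrightarrow> ereal (\<gamma> i) \<in> {a..b} - ext_zeros K a b"
    and keeps: "keeps_vanishing K p a b"
    and endpoints: "\<And>e. e \<in> {a, b} \<Longrightarrow> \<not> vanishes_at K e \<Longrightarrow> vanishes_at (\<lambda>x. poly A x / K x) e"
  shows "\<exists>\<delta>. enumerates_zeros \<delta> q \<and>
    (\<forall>i\<in>{1..degree q}. ereal (\<delta> i) \<in> {a..b} - ext_zeros K a b) \<and>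
    ((\<forall>i\<in>{1..degree p}. ereal (\<gamma> i) \<in> {a<..<b}) \<longrightarrow>
      (\<forall>i\<in>{1..degree p}. \<delta> i < \<gamma> i \<and> \<gamma> i < \<delta> (i + 1)))"
proof -
  let ?n = "degree p"
  let ?Q = "\<lambda>x. poly q x = 0 \<and> ereal x \<in> {a..b} \<and> K x \<noteq> 0"
  have \<gamma>_mono: "strict_mono_on {1..?n} \<gamma>" and \<gamma>_zero: "\<And>i. i \<in> {1..?n} \<Longrightarrow> poly p (\<gamma> i) = 0"
    using \<gamma> by (auto simp: enumerates_zeros_def)
  have \<gamma>_bounds: "a \<le> ereal (\<gamma> i)" "ereal (\<gamma> i) \<le> b" "K (\<gamma> i) \<noteq> 0"
    "vanishes_at (\<lambda>x. K x * poly p x) (ereal (\<gamma> i))" if "i \<in> {1..?n}" for i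
    using \<gamma>_in[OF that] \<gamma>_zero[OF that] by (auto simp: ext_zeros_def)
  have end_in: "1 \<in> {1..?n}" "?n \<in> {1..?n}"
    using deg by auto
  have "\<exists>L. ?Q L \<and> L \<le> \<gamma> 1 \<and> (a < ereal (\<gamma> 1) \<longrightarrow> L < \<gamma> 1)"
  proof (cases "vanishes_at K a")
    case True
    then have "vanishes_at (\<lambda>x. K x * poly p x) a" "a < ereal (\<gamma> 1)"
      using keeps \<gamma>_bounds[OF end_in(1)] by (auto simp: keeps_vanishing_def less_le)
    then show ?thesis
      using zero_between[OF order_refl, of "ereal (\<gamma> 1)"] \<gamma>_bounds[OF end_in(1)]
      by (smt (verit, best) atLeastAtMost_iff ereal_less_eq(3) less_ereal.simps(1) less_imp_le order.trans)
  next
    case False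
    then obtain L where "a = ereal L" "poly q L = 0" "K L \<noteq> 0"
      using endpoints endpoint_zero by blast
    then show ?thesis
      using \<gamma>_bounds[OF end_in(1)] ab by (intro exI[of _ L]) auto
  qed
  then obtain L where L: "?Q L" "L \<le> \<gamma> 1" "a < ereal (\<gamma> 1) \<Longrightarrow> L < \<gamma> 1" by blast
  have "\<exists>R. ?Q R \<and> \<gamma> ?n \<le> R \<and> (ereal (\<gamma> ?n) < b \<longrightarrow> \<gamma> ?n < R)"
  proof (cases "vanishes_at K b")
    case True
    then have "vanishes_at (\<lambda>x. K x * poly p x) b" "ereal (\<gamma> ?n) < b"
      using keeps \<gamma>_bounds[OF end_in(2)] by (auto simp: keeps_vanishing_def less_le)
    then show ?thesis
      using zero_between[of "ereal (\<gamma> ?n)", OF _ _ order_refl] \<gamma>_bounds[OF end_in(2)]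
      by (smt (verit, best) atLeastAtMost_iff ereal_less_eq(3) less_ereal.simps(1) less_imp_le order.trans)
  next
    case False
    then obtain R where "b = ereal R" "poly q R = 0" "K R \<noteq> 0"
      using endpoints endpoint_zero by blast
    then show ?thesis
      using \<gamma>_bounds[OF end_in(2)] ab by (intro exI[of _ R]) auto
  qed
  then obtain R where R: "?Q R" "\<gamma> ?n \<le> R" "ereal (\<gamma> ?n) < b \<Longrightarrow> \<gamma> ?n < R" by blast
  (* L = R would squeeze all zeros of p onto both endpoints at once *)
  have "\<gamma> 1 \<le> \<gamma> ?n"
    using strict_mono_on_leD[OF \<gamma>_mono end_in] deg by simp
  then have "L < R"
    using L R ab \<gamma>_bounds[OF end_in(1)] \<gamma>_bounds[OF end_in(2)]
    by (metis less_le order.trans order.antisym leD)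
  moreover have "\<exists>x. ?Q x \<and> \<gamma> i < x \<and> x < \<gamma> (i + 1)" if i: "i \<in> {1..<?n}" for i
  proof -
    have i': "i \<in> {1..?n}" "i + 1 \<in> {1..?n}" using i by auto
    note bounds = \<gamma>_bounds[OF i'(1)] \<gamma>_bounds[OF i'(2)]
    have "ereal (\<gamma> i) < ereal (\<gamma> (i + 1))"
      using strict_mono_onD[OF \<gamma>_mono i'] by simp
    then obtain x where x: "poly q x = 0" "ereal (\<gamma> i) < ereal x" "ereal x < ereal (\<gamma> (i + 1))" "K x \<noteq> 0"
      using zero_between[of "ereal (\<gamma> i)" "ereal (\<gamma> (i + 1))"] bounds by blast
    then have "ereal x \<in> {a..b}"
      using bounds
      by (metis atLeastAtMost_iff less_imp_le order.trans)
    then show ?thesis using x by auto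
  qed
  ultimately obtain \<delta> where \<delta>: "strict_mono_on {1..?n + 1} \<delta>" "\<And>i. i \<in> {1..?n + 1} \<Longrightarrow> ?Q (\<delta> i)"
    "\<delta> 1 = L" "\<delta> (?n + 1) = R" "\<And>i. i \<in> {1..<?n} \<Longrightarrow> \<gamma> i < \<delta> (i + 1) \<and> \<delta> (i + 1) < \<gamma> (i + 1)"
    using interlacing_sequence_from_gaps[of ?n ?Q \<gamma> L R] deg(1) L(1,2) R(1,2) by blast
  show ?thesis
  proof (intro exI[of _ \<delta>] conjI impI ballI)
    show "enumerates_zeros \<delta> q"
      using \<delta>(1,2) deg by (auto simp: enumerates_zeros_def)
    show "ereal (\<delta> i) \<in> {a..b} - ext_zeros K a b" if "i \<in> {1..degree q}" for i
      using \<delta>(2)[of i] that deg(2) by (auto simp: ext_zeros_def)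
    fix i assume inner: "\<forall>i\<in>{1..?n}. ereal (\<gamma> i) \<in> {a<..<b}" and i: "i \<in> {1..?n}"
    show "\<delta> i < \<gamma> i"
    proof (cases "i = 1")
      case True
      then show ?thesis
        using \<delta>(3) L(3) bspec[OF inner end_in(1)] by simp
    next
      case False
      then have "i - 1 \<in> {1..<?n}" "i - 1 + 1 = i"
        using i by auto
      then show ?thesis
        using \<delta>(5)[of "i - 1"] by simp
    qed
    show "\<gamma> i < \<delta> (i + 1)"
      using \<delta>(4) R(3) bspec[OF inner end_in(2)] \<delta>(5)[of i] i by (cases "i = ?n") auto
  qed
qed

end

section \<open>Propagation of the zeros along the sequence\<close>

locale raising_sequence =
  fixes P A B :: "nat \<Rightarrow> real poly" and K :: "nat \<Rightarrow> real \<Rightarrow> real"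
    and \<alpha> \<beta> :: "nat \<Rightarrow> ereal" and N :: nat
  assumes P_Suc: "\<And>n. P (n + 1) = A n * pderiv (P n) + B n * P n"
    and deg_P: "\<And>n. degree (P n) = n"
    and nested: "\<And>n. n \<in> {1..N} \<Longrightarrow> \<alpha> (n + 1) \<le> \<alpha> n \<and> \<alpha> n < \<beta> n \<and> \<beta> n \<le> \<beta> (n + 1)"
    and weight: "\<And>n. n \<in> {1..N} \<Longrightarrow> is_weight (A n) (B n) (\<alpha> n) (\<beta> n) (K n)"
    and cont: "\<And>n. n \<in> {1..N} \<Longrightarrow> ext_continuous_on (\<alpha> n) (\<beta> n) (K n)"
begin

definition nonvanishing_points :: "nat \<Rightarrow> ereal set" where
  "nonvanishing_points n = {\<alpha> n..\<beta> n} - ext_zeros (K n) (\<alpha> n) (\<beta> n)"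

text \<open>What the parts of the theorem assume about \<open>K n\<close> at the endpoints, stated for each endpoint
  separately so that all combinations of a vanishing and a nonvanishing \<open>K n\<close> are covered at once.\<close>

definition regular_endpoints :: "nat \<Rightarrow> bool" where
  "regular_endpoints n \<longleftrightarrow> keeps_vanishing (K n) (P n) (\<alpha> n) (\<beta> n) \<and>
     (\<forall>e\<in>{\<alpha> n, \<beta> n}. \<not> vanishes_at (K n) e \<longrightarrow> vanishes_at (\<lambda>x. poly (A n) x / K n x) e)"

lemma weighted_raising:
  assumes "n \<in> {1..N}"
  shows "weighted_raising (A n) (B n) (P n) (P (n + 1)) (\<alpha> n) (\<beta> n) (K n)"
  using assms P_Suc nested weight cont by unfold_locales auto

lemma open_interval_subset_nonvanishing_points:
  assumes "n \<in> {1..N}"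
  shows "{\<alpha> n<..<\<beta> n} \<subseteq> nonvanishing_points n"
proof
  fix e assume e: "e \<in> {\<alpha> n<..<\<beta> n}"
  then obtain x where "e = ereal x"
    by (cases e) auto
  then show "e \<in> nonvanishing_points n"
    using e weighted_raising.inside(2)[OF weighted_raising[OF assms]]
    by (auto simp: nonvanishing_points_def ext_zeros_def)
qed

lemma next_zeros:
  assumes n: "n \<in> {1..N}" "regular_endpoints n"
    and \<gamma>: "enumerates_zeros \<gamma> (P n)" "\<And>i. i \<in> {1..n} \<Longrightarrow> ereal (\<gamma> i) \<in> nonvanishing_points n"
  shows "\<exists>\<delta>. enumerates_zeros \<delta> (P (n + 1)) \<and> (\<forall>i\<in>{1..n + 1}. ereal (\<delta> i) \<in> nonvanishing_points n) \<and>
    ((\<forall>i\<in>{1..n}. ereal (\<gamma> i) \<in> {\<alpha> n<..<\<beta> n}) \<longrightarrow>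
      (\<forall>i\<in>{1..n}. \<delta> i < \<gamma> i \<and> \<gamma> i < \<delta> (i + 1)))"
proof -
  have "1 \<le> degree (P n)" "degree (P (n + 1)) = degree (P n) + 1"
    using n(1) by (simp_all only: deg_P atLeastAtMost_iff)
  moreover have "ereal (\<gamma> i) \<in> {\<alpha> n..\<beta> n} - ext_zeros (K n) (\<alpha> n) (\<beta> n)"
    if "i \<in> {1..degree (P n)}" for i
    using that \<gamma>(2) by (simp add: deg_P nonvanishing_points_def)
  ultimately show ?thesis
    using weighted_raising.next_zeros[OF weighted_raising[OF n(1)] \<gamma>(1)] n(2)
    unfolding deg_P regular_endpoints_def nonvanishing_points_def by blast
qed

text \<open>The induction is stated for a family of sets \<open>S\<close> because it is used with two of them: the open
  intervals, which guarantee interlacing at the next step, and the sets \<open>nonvanishing_points\<close>, which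
  allow a zero at an endpoint.\<close>

lemma zeros_propagate:
  assumes start: "ereal (nth_zero 1 (P 1)) \<in> S 1"
    and subset: "\<And>k. k \<in> {1..<N} \<Longrightarrow> S k \<subseteq> nonvanishing_points k"
    and regular: "\<And>k. k \<in> {1..<N} \<Longrightarrow> regular_endpoints k"
    and grow: "\<And>k. k \<in> {1..<N} \<Longrightarrow> nonvanishing_points k \<subseteq> S (k + 1)"
    and "1 \<le> n" "n \<le> N"
  shows "\<exists>\<gamma>. enumerates_zeros \<gamma> (P n) \<and> (\<forall>i\<in>{1..n}. ereal (\<gamma> i) \<in> S n)"
  using \<open>1 \<le> n\<close> \<open>n \<le> N\<close>
proof (induction n rule: dec_induct)
  case base
  have "degree (P 1) = 1" by (rule deg_P)
  then obtain c d where P1: "P 1 = [:d, c:]" "c \<noteq> 0"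
    by (metis degree1_coeffs)
  then have enum: "enumerates_zeros (\<lambda>_. - d / c) (P 1)"
    by (auto simp: enumerates_zeros_def strict_mono_on_def)
  then have "nth_zero 1 (P 1) = - d / c"
    by (rule enumerates_zeros_nth_zero) (simp add: deg_P del: One_nat_def)
  then show ?case
    using start enum by auto
next
  case (step k)
  then have k: "k \<in> {1..<N}" "k \<in> {1..N}" by auto
  from step obtain \<gamma> where "enumerates_zeros \<gamma> (P k)" "\<forall>i\<in>{1..k}. ereal (\<gamma> i) \<in> S k"
    by auto
  then obtain \<delta> where "enumerates_zeros \<delta> (P (k + 1))" "\<forall>i\<in>{1..k + 1}. ereal (\<delta> i) \<in> nonvanishing_points k"
    using next_zeros[OF k(2) regular[OF k(1)]] subset[OF k(1)] by blast
  then show ?case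
    using grow[OF k(1)] by auto
qed

lemma zeros_in_nonvanishing_points:
  assumes "ereal (nth_zero 1 (P 1)) \<in> nonvanishing_points 1"
    and "\<And>k. k \<in> {1..<N} \<Longrightarrow> regular_endpoints k"
    and "\<And>k. k \<in> {1..<N} \<Longrightarrow> nonvanishing_points k \<subseteq> nonvanishing_points (k + 1)"
    and n: "n \<in> {1..N}"
  shows "zeros_real_simple (P n) \<and> zeros_in (P n) (nonvanishing_points n)"
proof -
  obtain \<gamma> where "enumerates_zeros \<gamma> (P n)" "\<forall>i\<in>{1..n}. ereal (\<gamma> i) \<in> nonvanishing_points n"
    using zeros_propagate[of nonvanishing_points n] assms by auto
  then show ?thesis
    using enumerates_zeros_real_simple enumerates_zeros_in deg_P by metis
qed

text \<open>Each step may place a zero on an endpoint where \<open>K\<close> does not vanish. The strict growth of the interval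
  at exactly these endpoints moves that zero into the interior for the next step.\<close>

lemma zeros_interlace_in_open_interval:
  assumes start: "\<alpha> 1 < ereal (nth_zero 1 (P 1))" "ereal (nth_zero 1 (P 1)) < \<beta> 1"
    and regular: "\<And>k. k \<in> {1..N} \<Longrightarrow> regular_endpoints k"
    and grow: "\<And>k. k \<in> {1..N} \<Longrightarrow> \<not> vanishes_at (K k) (\<alpha> k) \<Longrightarrow> \<alpha> (k + 1) < \<alpha> k"
      "\<And>k. k \<in> {1..N} \<Longrightarrow> \<not> vanishes_at (K k) (\<beta> k) \<Longrightarrow> \<beta> k < \<beta> (k + 1)"
    and n: "n \<in> {1..N}"
  shows "zeros_interlace (P n) (P (n + 1)) \<and>
    zeros_in (P n) {\<alpha> n<..<\<beta> n} \<and> zeros_in (P (n + 1)) (nonvanishing_points n)"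
proof -
  have "nonvanishing_points k \<subseteq> {\<alpha> (k + 1)<..<\<beta> (k + 1)}" if k: "k \<in> {1..N}" for k
  proof
    fix e assume e: "e \<in> nonvanishing_points k"
    then have "\<alpha> k \<le> e" "e \<le> \<beta> k" "\<not> vanishes_at (K k) e"
      by (auto simp: nonvanishing_points_def ext_zeros_def)
    then have "\<alpha> (k + 1) < e" "e < \<beta> (k + 1)"
      using nested[OF k] grow[OF k]
      by (metis order.strict_trans1 order.strict_trans2 order.not_eq_order_implies_strict)+
    then show "e \<in> {\<alpha> (k + 1)<..<\<beta> (k + 1)}"
      by simp
  qed
  then obtain \<gamma> where \<gamma>: "enumerates_zeros \<gamma> (P n)" "\<forall>i\<in>{1..n}. ereal (\<gamma> i) \<in> {\<alpha> n<..<\<beta> n}"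
    using zeros_propagate[of "\<lambda>k. {\<alpha> k<..<\<beta> k}" n] start regular n open_interval_subset_nonvanishing_points
    by auto
  moreover obtain \<delta> where \<delta>: "enumerates_zeros \<delta> (P (n + 1))" "\<forall>i\<in>{1..n + 1}. ereal (\<delta> i) \<in> nonvanishing_points n"
    "\<forall>i\<in>{1..n}. \<delta> i < \<gamma> i \<and> \<gamma> i < \<delta> (i + 1)"
    using next_zeros[OF n regular[OF n] \<gamma>(1)] \<gamma>(2) open_interval_subset_nonvanishing_points[OF n] by blast
  ultimately show ?thesis
    using enumerates_zeros_interlace[of \<gamma> "P n" \<delta> "P (n + 1)"]
      enumerates_zeros_in[of \<gamma> "P n"] enumerates_zeros_in[of \<delta> "P (n + 1)"]
    unfolding deg_P by blast
qed

lemma vanishes_at_endpoint_iff: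
  assumes "n \<in> {1..N}"
  shows "vanishes_at (K n) (\<alpha> n) \<longleftrightarrow> \<alpha> n \<in> ext_zeros (K n) (\<alpha> n) (\<beta> n)"
    and "vanishes_at (K n) (\<beta> n) \<longleftrightarrow> \<beta> n \<in> ext_zeros (K n) (\<alpha> n) (\<beta> n)"
proof -
  have "\<alpha> n \<le> \<beta> n"
    using nested[OF assms] less_imp_le by blast
  then show "vanishes_at (K n) (\<alpha> n) \<longleftrightarrow> \<alpha> n \<in> ext_zeros (K n) (\<alpha> n) (\<beta> n)"
    and "vanishes_at (K n) (\<beta> n) \<longleftrightarrow> \<beta> n \<in> ext_zeros (K n) (\<alpha> n) (\<beta> n)"
    by (simp_all add: ext_zeros_def)
qed

end

theorem theorem5:
  fixes P A B :: "nat \<Rightarrow> real poly" and K :: "nat \<Rightarrow> real \<Rightarrow> real"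
    and \<alpha> \<beta> :: "nat \<Rightarrow> ereal" and N :: nat
  assumes P_0: "P 0 = 1"
    and P_Suc: "\<And>n. P (n + 1) = A n * pderiv (P n) + B n * P n"
    and deg_A: "\<And>n. degree (A n) \<le> 2"
    and deg_B: "\<And>n. degree (B n) \<le> 1"
    and deg_P: "\<And>n. degree (P n) = n"
    and N: "1 \<le> N"
    and nested: "\<And>n. n \<in> {1..N} \<Longrightarrow>
      \<alpha> (n + 1) \<le> \<alpha> n \<and> \<alpha> n < \<beta> n \<and> \<beta> n \<le> \<beta> (n + 1)"
    and K_def: "\<And>n. n \<in> {1..N} \<Longrightarrow> is_weight (A n) (B n) (\<alpha> n) (\<beta> n) (K n)"
    and K_cont: "\<And>n. n \<in> {1..N} \<Longrightarrow> ext_continuous_on (\<alpha> n) (\<beta> n) (K n)"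
    and K_diff: "\<And>n. n \<in> {1..N} \<Longrightarrow> K n differentiable_on {x. ereal x \<in> {\<alpha> n<..<\<beta> n}}"
  shows
    "\<comment> \<open>(a)\<close>
     ((\<forall>n\<in>{1..N}. ext_zeros (K n) (\<alpha> n) (\<beta> n) = {\<alpha> n, \<beta> n} \<and>
          keeps_vanishing (K n) (P n) (\<alpha> n) (\<beta> n)) \<and>
      \<alpha> 1 < ereal (nth_zero 1 (P 1)) \<and> ereal (nth_zero 1 (P 1)) < \<beta> 1 \<longrightarrow>
      (\<forall>n\<in>{1..N}. zeros_interlace (P n) (P (n + 1)) \<and>
          zeros_in (P n) {\<alpha> n<..<\<beta> n} \<and> zeros_in (P (n + 1)) {\<alpha> n<..<\<beta> n})) \<and>
     \<comment> \<open>(b)\<close>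
     ((\<forall>n\<in>{1..N}. ext_zeros (K n) (\<alpha> n) (\<beta> n) = {\<alpha> n} \<and>
          vanishes_at (\<lambda>x. poly (A n) x / K n x) (\<beta> n) \<and>
          keeps_vanishing (K n) (P n) (\<alpha> n) (\<beta> n) \<and> \<beta> n < \<beta> (n + 1)) \<and>
      \<alpha> 1 < ereal (nth_zero 1 (P 1)) \<and> ereal (nth_zero 1 (P 1)) < \<beta> 1 \<longrightarrow>
      (\<forall>n\<in>{1..N}. zeros_interlace (P n) (P (n + 1)) \<and>
          zeros_in (P n) {\<alpha> n<..<\<beta> n} \<and> zeros_in (P (n + 1)) {\<alpha> n<..\<beta> n})) \<and>
     \<comment> \<open>(b), respectively\<close>
     ((\<forall>n\<in>{1..N}. ext_zeros (K n) (\<alpha> n) (\<beta> n) = {\<beta> n} \<and>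
          vanishes_at (\<lambda>x. poly (A n) x / K n x) (\<alpha> n) \<and>
          keeps_vanishing (K n) (P n) (\<alpha> n) (\<beta> n) \<and> \<alpha> (n + 1) < \<alpha> n) \<and>
      \<alpha> 1 < ereal (nth_zero 1 (P 1)) \<and> ereal (nth_zero 1 (P 1)) < \<beta> 1 \<longrightarrow>
      (\<forall>n\<in>{1..N}. zeros_interlace (P n) (P (n + 1)) \<and>
          zeros_in (P n) {\<alpha> n<..<\<beta> n} \<and> zeros_in (P (n + 1)) {\<alpha> n..<\<beta> n})) \<and>
     \<comment> \<open>(c)\<close>
     ((\<forall>n\<in>{1..N}. ext_zeros (K n) (\<alpha> n) (\<beta> n) = {\<alpha> n} \<and>
          vanishes_at (\<lambda>x. poly (A n) x / K n x) (\<beta> n)) \<and>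
      (\<forall>n\<in>{1..<N}. keeps_vanishing (K n) (P n) (\<alpha> n) (\<beta> n)) \<and>
      \<alpha> 1 < ereal (nth_zero 1 (P 1)) \<and> ereal (nth_zero 1 (P 1)) \<le> \<beta> 1 \<longrightarrow>
      (\<forall>n\<in>{1..N}. zeros_real_simple (P n) \<and> zeros_in (P n) {\<alpha> n<..\<beta> n})) \<and>
     \<comment> \<open>(c), respectively\<close>
     ((\<forall>n\<in>{1..N}. ext_zeros (K n) (\<alpha> n) (\<beta> n) = {\<beta> n} \<and>
          vanishes_at (\<lambda>x. poly (A n) x / K n x) (\<alpha> n)) \<and>
      (\<forall>n\<in>{1..<N}. keeps_vanishing (K n) (P n) (\<alpha> n) (\<beta> n)) \<and>
      \<alpha> 1 \<le> ereal (nth_zero 1 (P 1)) \<and> ereal (nth_zero 1 (P 1)) < \<beta> 1 \<longrightarrow>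
      (\<forall>n\<in>{1..N}. zeros_real_simple (P n) \<and> zeros_in (P n) {\<alpha> n..<\<beta> n})) \<and>
     \<comment> \<open>(d)\<close>
     ((\<forall>n\<in>{1..N}. ext_zeros (K n) (\<alpha> n) (\<beta> n) = {} \<and>
          vanishes_at (\<lambda>x. poly (A n) x / K n x) (\<alpha> n) \<and>
          vanishes_at (\<lambda>x. poly (A n) x / K n x) (\<beta> n) \<and>
          \<alpha> (n + 1) < \<alpha> n \<and> \<alpha> n < \<beta> n \<and> \<beta> n < \<beta> (n + 1)) \<and>
      \<alpha> 1 < ereal (nth_zero 1 (P 1)) \<and> ereal (nth_zero 1 (P 1)) < \<beta> 1 \<longrightarrow>
      (\<forall>n\<in>{1..N}. zeros_interlace (P n) (P (n + 1))))"
proof -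
  interpret raising_sequence P A B K \<alpha> \<beta> N
    by unfold_locales (fact P_Suc deg_P nested K_def K_cont)+
  let ?z = "ereal (nth_zero 1 (P 1))"
  let ?Z = "\<lambda>n. ext_zeros (K n) (\<alpha> n) (\<beta> n)"
  have one: "1 \<in> {1..N}" using N by simp
  have ends: "\<alpha> n \<noteq> \<beta> n" if "n \<in> {1..N}" for n
    using nested[OF that] by auto
  have nonvanishing_both: "nonvanishing_points n = {\<alpha> n<..<\<beta> n}" if "?Z n = {\<alpha> n, \<beta> n}" for n
    unfolding nonvanishing_points_def that by (auto simp: less_le)
  have nonvanishing_left: "nonvanishing_points n = {\<alpha> n<..\<beta> n}" if "?Z n = {\<alpha> n}" for n
    unfolding nonvanishing_points_def that by (auto simp: less_le)
  have nonvanishing_right: "nonvanishing_points n = {\<alpha> n..<\<beta> n}" if "?Z n = {\<beta> n}" for n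
    unfolding nonvanishing_points_def that by (auto simp: less_le)
  show ?thesis
  proof (intro conjI impI, goal_cases)
    case 1
    then have start: "\<alpha> 1 < ?z" "?z < \<beta> 1"
      and Z: "?Z n = {\<alpha> n, \<beta> n}" and regular: "regular_endpoints n"
      and grow: "\<not> vanishes_at (K n) (\<alpha> n) \<Longrightarrow> \<alpha> (n + 1) < \<alpha> n"
        "\<not> vanishes_at (K n) (\<beta> n) \<Longrightarrow> \<beta> n < \<beta> (n + 1)" if "n \<in> {1..N}" for n
      using that ends[OF that]
      by (simp_all add: regular_endpoints_def vanishes_at_endpoint_iff[OF that] del: Suc_eq_plus1)
    show ?case
      using zeros_interlace_in_open_interval[OF start regular grow] one Z nonvanishing_both by metis
  next
    case 2
    then have start: "\<alpha> 1 < ?z" "?z < \<beta> 1"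
      and Z: "?Z n = {\<alpha> n}" and regular: "regular_endpoints n"
      and grow: "\<not> vanishes_at (K n) (\<alpha> n) \<Longrightarrow> \<alpha> (n + 1) < \<alpha> n"
        "\<not> vanishes_at (K n) (\<beta> n) \<Longrightarrow> \<beta> n < \<beta> (n + 1)" if "n \<in> {1..N}" for n
      using that ends[OF that]
      by (simp_all add: regular_endpoints_def vanishes_at_endpoint_iff[OF that] del: Suc_eq_plus1)
    show ?case
      using zeros_interlace_in_open_interval[OF start regular grow] one Z nonvanishing_left by metis
  next
    case 3
    then have start: "\<alpha> 1 < ?z" "?z < \<beta> 1"
      and Z: "?Z n = {\<beta> n}" and regular: "regular_endpoints n"
      and grow: "\<not> vanishes_at (K n) (\<alpha> n) \<Longrightarrow> \<alpha> (n + 1) < \<alpha> n"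
        "\<not> vanishes_at (K n) (\<beta> n) \<Longrightarrow> \<beta> n < \<beta> (n + 1)" if "n \<in> {1..N}" for n
      using that ends[OF that]
      by (simp_all add: regular_endpoints_def vanishes_at_endpoint_iff[OF that] del: Suc_eq_plus1)
    show ?case
      using zeros_interlace_in_open_interval[OF start regular grow] one Z nonvanishing_right by metis
  next
    case 4
    then have Z: "?Z n = {\<alpha> n}" if "n \<in> {1..N}" for n
      using that by blast
    have regular: "regular_endpoints n" if "n \<in> {1..<N}" for n
    proof -
      have n: "n \<in> {1..N}" using that by simp
      show ?thesis
        using 4 n that ends[OF n]
        by (simp add: regular_endpoints_def vanishes_at_endpoint_iff[OF n])
    qed
    have grow: "nonvanishing_points n \<subseteq> nonvanishing_points (n + 1)" if "n \<in> {1..<N}" for n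
    proof -
      have n: "n \<in> {1..N}" "n + 1 \<in> {1..N}" using that by auto
      show ?thesis
        unfolding nonvanishing_left[OF Z[OF n(1)]] nonvanishing_left[OF Z[OF n(2)]]
        using nested[OF n(1)] by (auto intro: order.trans order.strict_trans1)
    qed
    have start: "?z \<in> nonvanishing_points 1"
      using 4 nonvanishing_left[OF Z[OF one]] by simp
    show ?case
      using zeros_in_nonvanishing_points[OF start regular grow] Z nonvanishing_left by metis
  next
    case 5
    then have Z: "?Z n = {\<beta> n}" if "n \<in> {1..N}" for n
      using that by blast
    have regular: "regular_endpoints n" if "n \<in> {1..<N}" for n
    proof -
      have n: "n \<in> {1..N}" using that by simp
      show ?thesis
        using 5 n that ends[OF n]
        by (simp add: regular_endpoints_def vanishes_at_endpoint_iff[OF n])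
    qed
    have grow: "nonvanishing_points n \<subseteq> nonvanishing_points (n + 1)" if "n \<in> {1..<N}" for n
    proof -
      have n: "n \<in> {1..N}" "n + 1 \<in> {1..N}" using that by auto
      show ?thesis
        unfolding nonvanishing_right[OF Z[OF n(1)]] nonvanishing_right[OF Z[OF n(2)]]
        using nested[OF n(1)] by (auto intro: order.trans order.strict_trans2)
    qed
    have start: "?z \<in> nonvanishing_points 1"
      using 5 nonvanishing_right[OF Z[OF one]] by simp
    show ?case
      using zeros_in_nonvanishing_points[OF start regular grow] Z nonvanishing_right by metis
  next
    case 6
    (* K n has no zeros, so that keeps_vanishing holds vacuously *)
    then have start: "\<alpha> 1 < ?z" "?z < \<beta> 1"
      and regular: "regular_endpoints n"
      and grow: "\<not> vanishes_at (K n) (\<alpha> n) \<Longrightarrow> \<alpha> (n + 1) < \<alpha> n"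
        "\<not> vanishes_at (K n) (\<beta> n) \<Longrightarrow> \<beta> n < \<beta> (n + 1)" if "n \<in> {1..N}" for n
      using that ends[OF that]
      by (simp_all add: regular_endpoints_def keeps_vanishing_def
        vanishes_at_endpoint_iff[OF that] del: Suc_eq_plus1)
    show ?case
      using zeros_interlace_in_open_interval[OF start regular grow] by blast
  qed
qed

end
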